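(* Consider the online general knapsack problem with reservation in which the reservation cost of an item is proportional to its value, with reservation factor $0<\alpha<\tfrac12$. Every online algorithm $\mathtt{A}$ has strict competitive ratio \[{\rm CR}(\mathtt{A})=\sup_S \frac{{\rm gain}_{\mathtt{OPT}}(S)}{{\rm gain}_{\mathtt{A}}(S)}\ \ge\ \frac{2\bigl(1-\alpha+\sqrt{(2-3\alpha)\alpha}\bigr)}{(1-2\alpha)^2}.\]
   Context: Online general knapsack with reservation: the knapsack has capacity $1$. Items $x=(s_x,v_x)$ with size $0<s_x\le 1$ and value $v_x> 0$ arrive one by one. When an item arrives, a (deterministic) online algorithm must immediately and irrevocably either pack it, reject it, or reserve it. After the whole sequence has arrived, the algorithm may pack any subset of the reserved items that fits into the knapsack together with the already packed items (total size at most $1$). Every reserved item incurs a reservation cost, paid regardless of whether the item is finally packed; here the cost of reserving $x$ is $\alpha\cdot v_x$. The gain of an algorithm on a sequence $S$ is the total value of packed items minus the total reservation costs; ${\rm gain}_{\mathtt{OPT}}(S)$ is the maximum total value of a subset of items of $S$ of total size at most $1$. In the supremum, a sequence with ${\rm gain}_{\mathtt{A}}(S)\le 0<{\rm gain}_{\mathtt{OPT}}(S)$ counts as ratio $+\infty$. *)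

theory Defs
  imports "HOL-Library.Extended_Real"
begin

datatype item = Item (item_size: real) (item_value: real)

definition valid_item :: "item \<Rightarrow> bool" where
  "valid_item x \<longleftrightarrow> 0 < item_size x \<and> item_size x \<le> 1 \<and> 0 < item_value x"

definition valid_sequence :: "item list \<Rightarrow> bool" where
  "valid_sequence S \<longleftrightarrow> (\<forall>x \<in> set S. valid_item x)"

text \<open>Identical items may occur several times in a sequence, so selections are sets of
  positions rather than sets of items.\<close>

definition total_size :: "item list \<Rightarrow> nat set \<Rightarrow> real" where
  "total_size S I = (\<Sum>i\<in>I. item_size (S ! i))"

definition total_value :: "item list \<Rightarrow> nat set \<Rightarrow> real" where
  "total_value S I = (\<Sum>i\<in>I. item_value (S ! i))"

datatype decision = Pack | Reject | Reserve

text \<open>\<open>decide A\<close> is applied to the nonempty prefix of the sequence that ends with the item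
  just arrived; earlier decisions need not be passed since a deterministic algorithm can
  recompute them. \<open>final_pick A S\<close> is the set of positions of the reserved items
  packed after the whole sequence \<open>S\<close> has arrived.\<close>

datatype algorithm =
  Algorithm (decide: "item list \<Rightarrow> decision") (final_pick: "item list \<Rightarrow> nat set")

definition positions :: "algorithm \<Rightarrow> decision \<Rightarrow> item list \<Rightarrow> nat set" where
  "positions A d S = {i. i < length S \<and> decide A (take (Suc i) S) = d}"

definition final_packing :: "algorithm \<Rightarrow> item list \<Rightarrow> nat set" where
  "final_packing A S = positions A Pack S \<union> final_pick A S"

text \<open>Every prefix of a valid sequence is itself a valid sequence, so the capacity bound below
  also holds at every intermediate step.\<close>

definition online_algorithm :: "algorithm \<Rightarrow> bool" where
  "online_algorithm A \<longleftrightarrow>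
     (\<forall>S. valid_sequence S \<longrightarrow>
        final_pick A S \<subseteq> positions A Reserve S \<and> total_size S (final_packing A S) \<le> 1)"

definition gain :: "real \<Rightarrow> algorithm \<Rightarrow> item list \<Rightarrow> real" where
  "gain \<alpha> A S = total_value S (final_packing A S)
     - (\<Sum>i\<in>positions A Reserve S. \<alpha> * item_value (S ! i))"

definition gain_OPT :: "item list \<Rightarrow> real" where
  "gain_OPT S = Max {total_value S I | I. I \<subseteq> {..<length S} \<and> total_size S I \<le> 1}"

text \<open>On valid sequences \<open>gain_OPT S > 0\<close> unless \<open>S\<close> is empty. For the empty
  sequence the second branch yields \<open>0 / 0 = 0\<close>, which does not influence the
  supremum, as every nonempty sequence has ratio at least 1.\<close>

definition ratio :: "real \<Rightarrow> algorithm \<Rightarrow> item list \<Rightarrow> ereal" where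
  "ratio \<alpha> A S =
     (if gain \<alpha> A S \<le> 0 \<and> 0 < gain_OPT S then \<infinity> else ereal (gain_OPT S / gain \<alpha> A S))"

definition competitive_ratio :: "real \<Rightarrow> algorithm \<Rightarrow> ereal" where
  "competitive_ratio \<alpha> A = (SUP S\<in>{S. valid_sequence S}. ratio \<alpha> A S)"

end

theory Submission
  imports Defs
begin

text \<open>Packing any item is fatal, since an item of size 1 and huge value may follow. So the adversary
  offers items of sizes just below 1, each slightly smaller than its predecessors, that the
  algorithm can only reserve or reject. If such an item of value \<open>w\<close> is
  rejected, items with exactly the complementary size and with the largest reserved value \<open>v\<close>
  follow: they fit together with each other and with the rejected item, but not with any reserved
  item. So rejecting all of them is fatal, and reserving one leaves a gain of
  at most \<open>(1 - \<alpha>) * v - \<alpha> * r\<close>, where \<open>r\<close> is the total value reserved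
  before, against an optimum of at least \<open>v + w\<close>. With the choice
  \<open>w = max v (c * ((1 - \<alpha>) * v - \<alpha> * r) - v)\<close> an algorithm with ratio below \<open>c\<close> must
  therefore reserve every large item. A negative discriminant makes \<open>r / v\<close> grow by a fixed amount
  in every step, until the reservation costs \<open>\<alpha> * r\<close> exceed \<open>v\<close>.\<close>

section \<open>Values of the large items\<close>

text \<open>Scaled to latest value 1, \<open>r\<close> is the total reserved, \<open>f\<close> the
  growth factor of the next value and \<open>1 + r / f\<close> the next ratio of total to latest
  value. Where the maximum is not 1, the increase times \<open>f\<close> is a quadratic in
  \<open>r\<close> whose discriminant is the left side of \<open>disc\<close>.\<close>

lemma reserved_ratio_step:
  fixes \<alpha> c :: real
  assumes \<alpha>: "0 < \<alpha>" "\<alpha> < 1 / 2" and c: "0 < c"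
    and disc: "(1 - 2 * \<alpha>)\<^sup>2 * c\<^sup>2 - 4 * (1 - \<alpha>) * c + 4 < 0"
  obtains \<eta> where "0 < \<eta>"
    and "\<And>r f. 0 \<le> r \<Longrightarrow> f = max 1 (c * ((1 - \<alpha>) - \<alpha> * r) - 1) \<Longrightarrow> r + \<eta> \<le> 1 + r / f"
proof -
  define d where "d = (1 - \<alpha>) * c - 1"
  define \<delta> where "\<delta> = (4 * c * \<alpha> * d - (c - 2)\<^sup>2) / (4 * c * \<alpha>)"
  have "4 * c * \<alpha> * d - (c - 2)\<^sup>2 = - ((1 - 2 * \<alpha>)\<^sup>2 * c\<^sup>2 - 4 * (1 - \<alpha>) * c + 4)"
    unfolding d_def by (simp add: power2_eq_square algebra_simps)
  then have num: "0 < 4 * c * \<alpha> * d - (c - 2)\<^sup>2"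
    using disc by linarith
  then have \<delta>: "0 < \<delta>"
    using \<alpha> c by (simp add: \<delta>_def)
  have "0 < (4 * c * \<alpha>) * d"
    using num by (smt (verit) zero_le_power2)
  then have d: "0 < d"
    by (rule zero_less_mult_pos) (simp add: \<alpha> c)
  show ?thesis
  proof (rule that)
    \<comment> \<open>The increase is exactly 1 if \<open>f = 1\<close>, and otherwise at least
      \<open>\<delta> / f\<close>, where \<open>f \<le> d\<close>.\<close>
    show "0 < min 1 (\<delta> / d)"
      using \<delta> d by simp
    fix r f :: real
    assume r: "0 \<le> r" and f: "f = max 1 (c * ((1 - \<alpha>) - \<alpha> * r) - 1)"
    show "r + min 1 (\<delta> / d) \<le> 1 + r / f"
    proof (cases "f = 1")
      case False
      then have f': "f = d - c * \<alpha> * r" and f1: "1 < f"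
        using f by (auto simp: d_def algebra_simps max_def split: if_splits)
      have fd: "f \<le> d"
        using f' r \<alpha> c by simp
      \<comment> \<open>Completing the square shows that \<open>\<delta>\<close> is the minimum of
        the quadratic.\<close>
      have "f + r - r * f = c * \<alpha> * (r - (c - 2) / (2 * c * \<alpha>))\<^sup>2 + \<delta>"
        using \<alpha> c unfolding f' \<delta>_def d_def
        by (simp add: field_simps power2_eq_square)
      then have "\<delta> \<le> f + r - r * f"
        using \<alpha> c by simp
      then have "\<delta> / f \<le> (f + r - r * f) / f"
        using f1 by (simp add: divide_right_mono)
      also have "\<dots> = 1 + r / f - r"
        using f1 by (simp add: field_simps)
      finally have "\<delta> / f \<le> 1 + r / f - r" .
      moreover have "\<delta> / d \<le> \<delta> / f"
        using fd f1 \<delta> by (simp add: frac_le)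
      ultimately show ?thesis
        by linarith
    qed simp
  qed
qed

text \<open>The ratio of the sum to \<open>V n\<close> grows by at least \<open>\<eta>\<close> per
  step, so it eventually reaches \<open>1 / \<alpha>\<close>, which is the last conclusion. The
  third one is what punishes rejecting the item of value \<open>V (Suc n)\<close>.\<close>

lemma offered_values:
  fixes \<alpha> c :: real
  assumes \<alpha>: "0 < \<alpha>" "\<alpha> < 1 / 2" and c: "0 < c"
    and disc: "(1 - 2 * \<alpha>)\<^sup>2 * c\<^sup>2 - 4 * (1 - \<alpha>) * c + 4 < 0"
  obtains V :: "nat \<Rightarrow> real" and N :: nat
    where "\<And>n. 0 < V n" and "incseq V"
      and "\<And>n. c * ((1 - \<alpha>) * V n - \<alpha> * (\<Sum>i\<le>n. V i)) \<le> V n + V (Suc n)"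
      and "V N \<le> \<alpha> * (\<Sum>i\<le>N. V i)"
proof -
  \<comment> \<open>The state pairs the latest value with the sum of all values so far, since the
    next value depends on both.\<close>
  define step where "step = (\<lambda>(v, r). let w = max v (c * ((1 - \<alpha>) * v - \<alpha> * r) - v) in (w, r + w))"
  define p where "p n = (step ^^ n) (1, 1 :: real)" for n
  define V where "V n = fst (p n)" for n
  have V_0: "V 0 = 1"
    by (simp add: V_def p_def)
  have snd_p: "snd (p n) = (\<Sum>i\<le>n. V i)" for n
    by (induction n) (auto simp: V_def p_def step_def Let_def split: prod.splits)
  have V_Suc: "V (Suc n) = max (V n) (c * ((1 - \<alpha>) * V n - \<alpha> * (\<Sum>i\<le>n. V i)) - V n)" for n
    unfolding snd_p[symmetric] by (simp add: V_def p_def step_def Let_def split: prod.splits)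
  have V_pos: "0 < V n" for n
    by (induction n) (auto simp: V_0 V_Suc)
  obtain \<eta> where \<eta>: "0 < \<eta>"
    and step: "\<And>r f. 0 \<le> r \<Longrightarrow> f = max 1 (c * ((1 - \<alpha>) - \<alpha> * r) - 1) \<Longrightarrow> r + \<eta> \<le> 1 + r / f"
    using reserved_ratio_step[OF \<alpha> c disc] by metis
  have ratio: "1 + real n * \<eta> \<le> (\<Sum>i\<le>n. V i) / V n" for n
  proof (induction n)
    case (Suc n)
    define r where "r = (\<Sum>i\<le>n. V i) / V n"
    define f where "f = V (Suc n) / V n"
    have sum: "(\<Sum>i\<le>n. V i) = r * V n"
      using V_pos[of n] by (simp add: r_def)
    have r: "0 \<le> r"
      using V_pos by (simp add: r_def sum_nonneg less_imp_le)
    have "V (Suc n) = V n * max 1 (c * ((1 - \<alpha>) - \<alpha> * r) - 1)"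
      using V_pos[of n] by (simp add: V_Suc sum max_mult_distrib_left algebra_simps)
    then have "f = max 1 (c * ((1 - \<alpha>) - \<alpha> * r) - 1)"
      using V_pos[of n] by (simp add: f_def)
    then have "r + \<eta> \<le> 1 + r / f"
      using step r by blast
    also have "1 + r / f = (\<Sum>i\<le>Suc n. V i) / V (Suc n)"
      using V_pos[of n] V_pos[of "Suc n"] by (simp add: sum f_def add_divide_distrib)
    finally show ?case
      using Suc.IH by (simp add: r_def algebra_simps)
  qed (simp add: V_0)
  obtain N where "1 / \<alpha> < real N * \<eta>"
    using reals_Archimedean3[OF \<eta>] by blast
  then have "1 / \<alpha> \<le> (\<Sum>i\<le>N. V i) / V N"
    using ratio[of N] by linarith
  then have "V N \<le> \<alpha> * (\<Sum>i\<le>N. V i)"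
    using V_pos[of N] \<alpha> by (simp add: field_simps)
  moreover have "incseq V"
    by (rule incseq_SucI) (simp add: V_Suc)
  moreover have "c * ((1 - \<alpha>) * V n - \<alpha> * (\<Sum>i\<le>n. V i)) \<le> V n + V (Suc n)" for n
    by (simp add: V_Suc)
  ultimately show ?thesis
    using that V_pos by blast
qed

section \<open>Gains and optima\<close>

lemma total_value_le_gain_OPT:
  assumes "I \<subseteq> {..<length S}" and "total_size S I \<le> 1"
  shows "total_value S I \<le> gain_OPT S"
  unfolding gain_OPT_def
proof (rule Max_ge)
  have "{total_value S I |I. I \<subseteq> {..<length S} \<and> total_size S I \<le> 1}
      \<subseteq> total_value S ` Pow {..<length S}"
    by auto
  then show "finite {total_value S I |I. I \<subseteq> {..<length S} \<and> total_size S I \<le> 1}"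
    by (rule finite_subset) simp
qed (use assms in blast)

lemma gain_OPT_nonneg: "0 \<le> gain_OPT S"
  using total_value_le_gain_OPT[of "{}" S] by (simp add: total_size_def total_value_def)

lemma gain_OPT_pos:
  assumes "valid_sequence S" and "S \<noteq> []"
  shows "0 < gain_OPT S"
proof -
  have "valid_item (S ! 0)"
    using assms by (simp add: valid_sequence_def)
  then show ?thesis
    using total_value_le_gain_OPT[of "{0}" S] assms
    by (simp add: total_size_def total_value_def valid_item_def)
qed

lemma valid_sequence_nth: "valid_sequence S \<Longrightarrow> i < length S \<Longrightarrow> valid_item (S ! i)"
  by (simp add: valid_sequence_def)

lemma valid_sequence_take: "valid_sequence S \<Longrightarrow> valid_sequence (take n S)"
  by (auto simp: valid_sequence_def dest: in_set_takeD)

lemma finite_positions [simp]: "finite (positions A d S)"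
  by (simp add: positions_def)

text \<open>The bound on the ratio is multiplied out. As the optimum is nonnegative and
  \<open>c\<close> positive, this form also forces a positive gain, so infinite ratios need no
  separate treatment.\<close>

locale competitive_algorithm =
  fixes \<alpha> c :: real and A :: algorithm
  assumes \<alpha>_pos: "0 < \<alpha>" and c_pos: "0 < c"
    and online: "online_algorithm A"
    and gain_OPT_less: "valid_sequence S \<Longrightarrow> S \<noteq> [] \<Longrightarrow> gain_OPT S < c * gain \<alpha> A S"
begin

lemma gain_pos:
  assumes "valid_sequence S" and "S \<noteq> []"
  shows "0 < gain \<alpha> A S"
  using gain_OPT_less[OF assms] gain_OPT_nonneg[of S] c_pos
  by (smt (verit) mult_nonneg_nonpos)

lemma final_packing_subset:
  assumes "valid_sequence S"
  shows "final_packing A S \<subseteq> {..<length S}"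
  using online assms by (auto simp: online_algorithm_def final_packing_def positions_def)

lemma never_packs:
  assumes valid: "valid_sequence S" and "S \<noteq> []"
  shows "decide A S \<noteq> Pack"
proof
  assume pack: "decide A S = Pack"
  define n where "n = length S - 1"
  have n: "Suc n = length S"
    using \<open>S \<noteq> []\<close> by (simp add: n_def)
  define W where "W = (\<Sum>i<length S. item_value (S ! i))"
  have nonneg: "0 \<le> item_value (S ! i)" if "i < length S" for i
    using valid_sequence_nth[OF valid that] by (simp add: valid_item_def)
  have W: "0 \<le> W"
    unfolding W_def by (rule sum_nonneg) (simp add: nonneg)
  \<comment> \<open>The packed item at position \<open>n\<close> leaves no room for an item of size
    1, so the gain on \<open>T\<close> is at most \<open>W\<close> and \<open>H\<close> only has to
    exceed \<open>c * W\<close>.\<close>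
  define H where "H = c * W + 1"
  define T where "T = S @ [Item 1 H]"
  have T: "valid_sequence T" "T \<noteq> []"
    using valid W c_pos by (auto simp: T_def H_def valid_sequence_def valid_item_def
        intro: add_nonneg_pos)
  let ?F = "final_packing A T"
  have finite: "finite ?F"
    using final_packing_subset[OF T(1)] finite_subset by blast
  have size_pos: "0 < item_size (T ! i)" if "i \<in> ?F" for i
    using that final_packing_subset[OF T(1)] valid_sequence_nth[OF T(1), of i]
    by (auto simp: valid_item_def)
  have mem: "n \<in> ?F"
    using pack n by (simp add: final_packing_def positions_def T_def)
  have "length S \<notin> ?F"
  proof
    assume last: "length S \<in> ?F"
    have "(\<Sum>i\<in>{n, length S}. item_size (T ! i)) \<le> total_size T ?F"
      unfolding total_size_def using mem last finite size_pos
      by (intro sum_mono2) (auto simp: less_imp_le)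
    moreover have "0 < item_size (T ! n)"
      using size_pos mem by blast
    moreover have "total_size T ?F \<le> 1"
      using online T(1) by (simp add: online_algorithm_def)
    ultimately show False
      using n by (simp add: T_def)
  qed
  then have F: "?F \<subseteq> {..<length S}"
    using final_packing_subset[OF T(1)] by (force simp: T_def less_Suc_eq)
  have "total_value T ?F = (\<Sum>i\<in>?F. item_value (S ! i))"
    unfolding total_value_def using F by (intro sum.cong) (auto simp: T_def nth_append)
  also have "\<dots> \<le> W"
    unfolding W_def using F nonneg by (intro sum_mono2) auto
  finally have "total_value T ?F \<le> W" .
  moreover have "0 \<le> (\<Sum>i\<in>positions A Reserve T. \<alpha> * item_value (T ! i))"
    using \<alpha>_pos valid_sequence_nth[OF T(1)]
    by (intro sum_nonneg) (auto simp: positions_def valid_item_def less_imp_le)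
  ultimately have "gain \<alpha> A T \<le> W"
    by (simp add: gain_def)
  then have "c * gain \<alpha> A T < H"
    using mult_left_mono[of "gain \<alpha> A T" W c] c_pos unfolding H_def by linarith
  moreover have "H \<le> gain_OPT T"
    using total_value_le_gain_OPT[of "{length S}" T]
    by (simp add: total_size_def total_value_def T_def)
  ultimately show False
    using gain_OPT_less[OF T] by simp
qed

lemma final_packing_reserved:
  assumes "valid_sequence S"
  shows "final_packing A S \<subseteq> positions A Reserve S"
proof -
  have "decide A (take (Suc i) S) \<noteq> Pack" if "i < length S" for i
    using that by (intro never_packs valid_sequence_take assms) auto
  then have "positions A Pack S = {}"
    by (auto simp: positions_def)
  then show ?thesis
    using online assms by (auto simp: online_algorithm_def final_packing_def)
qed

text \<open>Only reserved items can be packed, and no two of them fit together, so at most one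
  contributes its value while all of them are paid for. \<open>0 \<le> M\<close> covers the empty
  packing.\<close>

lemma gain_le_if_reserved_conflict:
  assumes valid: "valid_sequence S"
    and conflict: "\<And>i j. i \<in> positions A Reserve S \<Longrightarrow> j \<in> positions A Reserve S \<Longrightarrow> i < j \<Longrightarrow>
      1 < item_size (S ! i) + item_size (S ! j)"
    and value_le: "\<And>i. i \<in> positions A Reserve S \<Longrightarrow> item_value (S ! i) \<le> M"
    and M: "0 \<le> M"
  shows "gain \<alpha> A S \<le> M - \<alpha> * total_value S (positions A Reserve S)"
proof -
  let ?F = "final_packing A S"
  note F = final_packing_reserved[OF valid]
  have finite: "finite ?F"
    using finite_subset[OF F] by simp
  have no_pair: False if "i \<in> ?F" "j \<in> ?F" "i < j" for i j
  proof -
    have "(\<Sum>k\<in>{i, j}. item_size (S ! k)) \<le> total_size S ?F"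
      unfolding total_size_def using that finite valid_sequence_nth[OF valid] F
      by (intro sum_mono2) (auto simp: positions_def valid_item_def less_imp_le subset_iff)
    moreover have "total_size S ?F \<le> 1"
      using online valid by (simp add: online_algorithm_def)
    ultimately show False
      using conflict[of i j] that F by auto
  qed
  have "total_value S ?F \<le> M"
  proof (cases "?F = {}")
    case False
    then obtain i where "i \<in> ?F"
      by blast
    then have "?F = {i}"
      using no_pair by (auto dest: linorder_neqE_nat)
    then show ?thesis
      using value_le[of i] F by (simp add: total_value_def)
  qed (simp add: total_value_def M)
  then show ?thesis
    by (simp add: gain_def total_value_def sum_distrib_left)
qed

section \<open>The adversary\<close>

lemma reserves_all_large_items:
  fixes V :: "nat \<Rightarrow> real" and N :: nat
  assumes V_pos: "\<And>n. 0 < V n" and V_mono: "incseq V"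
    and V_step: "\<And>n. c * ((1 - \<alpha>) * V n - \<alpha> * (\<Sum>i\<le>n. V i)) \<le> V n + V (Suc n)"
  obtains \<epsilon> where "0 < \<epsilon>" and "\<And>i. i \<le> N \<Longrightarrow> real i * \<epsilon> < 1 / 2"
    and "\<And>n. n \<le> N \<Longrightarrow>
      decide A (map (\<lambda>i. Item (1 - real i * \<epsilon>) (V i)) [0..<Suc n]) = Reserve"
proof -
  \<comment> \<open>\<open>K\<close> copies worth \<open>V m\<close> each must beat
    \<open>c * V m\<close>, and \<open>K \<ge> 3\<close> keeps the large items above size 1/2. The
    choice of \<open>\<epsilon>\<close> lets \<open>K\<close> complementary items fit
    together.\<close>
  define K where "K = max 3 (nat \<lceil>c\<rceil>)"
  define \<epsilon> where "\<epsilon> = 1 / (real (Suc N) * real K)"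
  define large where "large n = map (\<lambda>i. Item (1 - real i * \<epsilon>) (V i)) [0..<n]" for n
  have K: "3 \<le> K" "c \<le> real K"
    unfolding K_def by linarith+
  have \<epsilon>_pos: "0 < \<epsilon>"
    using K by (simp add: \<epsilon>_def)
  have K\<epsilon>: "real K * (real i * \<epsilon>) < 1" if "i \<le> N" for i
  proof -
    have "real K * (real i * \<epsilon>) = real i / real (Suc N)"
      using K by (simp add: \<epsilon>_def)
    then show ?thesis
      using that by simp
  qed
  have small_\<epsilon>: "real i * \<epsilon> < 1 / 2" if "i \<le> N" for i
  proof -
    have "3 * (real i * \<epsilon>) \<le> real K * (real i * \<epsilon>)"
      using K \<epsilon>_pos by (intro mult_right_mono) auto
    then show ?thesis
      using K\<epsilon>[OF that] by linarith
  qed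
  have valid_large: "valid_sequence (large k)" if "k \<le> Suc N" for k
    unfolding valid_sequence_def
  proof
    fix x assume "x \<in> set (large k)"
    then obtain i where "i < k" "x = Item (1 - real i * \<epsilon>) (V i)"
      by (auto simp: large_def)
    then show "valid_item x"
      using that \<epsilon>_pos V_pos small_\<epsilon>[of i] by (simp add: valid_item_def)
  qed
  have "decide A (large (Suc n)) = Reserve" if "n \<le> N" for n
    using that
  proof (induction n rule: less_induct)
    case (less n)
    have IH: "decide A (large (Suc i)) = Reserve" if "i < n" for i
      using less that by simp
    have take_large: "take (Suc i) (large (Suc n) @ xs) = large (Suc i)" if "i \<le> n" for i xs
      using that by (simp add: large_def take_map take_upt del: upt_Suc)
    show ?case
    proof (rule ccontr)
      assume not_reserved: "decide A (large (Suc n)) \<noteq> Reserve"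
      show False
      proof (cases n)
        \<comment> \<open>With the first item not reserved, the gain is at most 0 already, so no
          further items are required.\<close>
        case 0
        then have "positions A Reserve (large 1) = {}"
          using not_reserved by (auto simp: positions_def large_def)
        then have "gain \<alpha> A (large 1) \<le> 0"
          using gain_le_if_reserved_conflict[OF valid_large[of 1], of 0]
          by (simp add: total_value_def)
        moreover have "0 < gain \<alpha> A (large 1)"
          using valid_large[of 1] by (intro gain_pos) (auto simp: large_def)
        ultimately show False
          by simp
      next
        case (Suc m)
        \<comment> \<open>This size complements item \<open>n\<close> exactly and exceeds the room
          left by any item \<open>i < n\<close>. By monotonicity \<open>V m\<close> is the largest
          reserved value.\<close>
        define small where "small = Item (real n * \<epsilon>) (V m)"
        define S where "S k = large (Suc n) @ replicate k small" for k
        have length_S: "length (S k) = Suc n + k" for k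
          by (simp add: S_def large_def)
        have S_nonempty: "S k \<noteq> []" for k
          by (simp add: S_def large_def)
        have S_large: "S k ! i = Item (1 - real i * \<epsilon>) (V i)" if "i \<le> n" for k i
          using that unfolding S_def large_def by (simp add: nth_append del: upt_Suc)
        have S_small: "S k ! i = small" if "n < i" "i \<le> n + k" for k i
          using that by (simp add: S_def large_def nth_append del: upt_Suc)
        have "valid_item small"
          using small_\<epsilon>[of n] less.prems \<epsilon>_pos V_pos Suc by (simp add: small_def valid_item_def)
        then have valid_S: "valid_sequence (S k)" for k
          using valid_large[of "Suc n"] less.prems by (auto simp: S_def valid_sequence_def)
        have take_S: "take (Suc i) (S k) = S (i - n)" if "n \<le> i" "i \<le> n + k" for i k
          using that by (simp add: S_def large_def del: upt_Suc)
        \<comment> \<open>The decision at position \<open>i \<ge> n\<close> is the one on the prefix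
          \<open>S (i - n)\<close>; \<open>S 0\<close> ends with large item \<open>n\<close>
          itself.\<close>
        have positions_S: "positions A Reserve (S k) =
            {..<n} \<union> {i. n \<le> i \<and> i \<le> n + k \<and> decide A (S (i - n)) = Reserve}" for k
        proof -
          have "decide A (take (Suc i) (S k)) = Reserve" if "i < n" for i
            using IH[OF that] take_large[OF less_imp_le[OF that]] by (simp only: S_def)
          then show ?thesis
            using take_S by (auto simp: positions_def length_S not_less)
        qed
        have V_le: "V i \<le> V m" if "i < n" for i
          using that V_mono Suc by (simp add: incseqD)
        have sum_V: "(\<Sum>i<n. item_value (S k ! i)) = (\<Sum>i\<le>m. V i)" for k
          using Suc by (intro sum.cong) (auto simp: S_large)
        have large_conflict: "1 < item_size (S k ! i) + item_size (S k ! j)"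
          if "i < n" "j < n" for i j k
          using that small_\<epsilon>[of i] small_\<epsilon>[of j] less.prems by (simp add: S_large)
        \<comment> \<open>Strong induction isolates the first copy to be reserved: all reserved
          items are then the large items below \<open>n\<close> and this one copy, and they conflict
          pairwise.\<close>
        have not_reserved_S: "decide A (S k) \<noteq> Reserve" for k
        proof (induction k rule: less_induct)
          case (less k)
          show ?case
          proof
            assume reserved: "decide A (S k) = Reserve"
            then have k: "0 < k"
              using not_reserved by (cases k) (auto simp: S_def)
            have pos: "positions A Reserve (S k) = insert (n + k) {..<n}"
              unfolding positions_S
            proof (intro equalityI subsetI)
              fix i assume "i \<in> {..<n} \<union> {i. n \<le> i \<and> i \<le> n + k \<and> decide A (S (i - n)) = Reserve}"
              then show "i \<in> insert (n + k) {..<n}"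
                using less[of "i - n"] by (cases "i = n + k") (auto simp: less_diff_conv2)
            qed (use reserved in auto)
            have "gain \<alpha> A (S k) \<le> V m - \<alpha> * total_value (S k) (positions A Reserve (S k))"
            proof (rule gain_le_if_reserved_conflict[OF valid_S])
              fix i j assume "i \<in> positions A Reserve (S k)" "j \<in> positions A Reserve (S k)" "i < j"
              then have "i < n" "j < n \<or> j = n + k"
                by (auto simp: pos)
              then show "1 < item_size (S k ! i) + item_size (S k ! j)"
                using large_conflict[of i j k] k \<epsilon>_pos by (auto simp: S_large S_small small_def)
            qed (use V_le V_pos k in \<open>auto simp: pos S_large S_small small_def less_imp_le\<close>)
            also have "total_value (S k) (positions A Reserve (S k)) = (\<Sum>i\<le>m. V i) + V m"
              using k by (simp add: pos total_value_def sum_V) (simp add: S_small small_def)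
            finally have "gain \<alpha> A (S k) \<le> (1 - \<alpha>) * V m - \<alpha> * (\<Sum>i\<le>m. V i)"
              by (simp add: algebra_simps)
            then have "c * gain \<alpha> A (S k) \<le> c * ((1 - \<alpha>) * V m - \<alpha> * (\<Sum>i\<le>m. V i))"
              using c_pos by simp
            also have "\<dots> \<le> V m + V n"
              using V_step Suc by simp
            \<comment> \<open>The rejected item \<open>n\<close> and the first copy fill the
              knapsack exactly.\<close>
            also have "\<dots> \<le> gain_OPT (S k)"
              using total_value_le_gain_OPT[of "{n, Suc n}" "S k"] k
              by (simp add: total_size_def total_value_def length_S S_large S_small small_def)
            finally show False
              using gain_OPT_less[OF valid_S S_nonempty, of k] by linarith
          qed
        qed
        then have pos: "positions A Reserve (S K) = {..<n}"
          unfolding positions_S by auto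
        have "gain \<alpha> A (S K) \<le> V m - \<alpha> * total_value (S K) (positions A Reserve (S K))"
          using large_conflict V_le V_pos
          by (intro gain_le_if_reserved_conflict[OF valid_S]) (auto simp: pos S_large less_imp_le)
        also have "\<dots> \<le> V m"
          using \<alpha>_pos V_pos by (simp add: pos total_value_def sum_V sum_nonneg less_imp_le)
        finally have "c * gain \<alpha> A (S K) \<le> c * V m"
          using c_pos by simp
        also have "\<dots> \<le> real K * V m"
          using K V_pos by (simp add: less_imp_le mult_right_mono)
        \<comment> \<open>Here the optimum is bounded by packing all \<open>K\<close> copies and
          nothing else.\<close>
        also have "\<dots> \<le> gain_OPT (S K)"
          using total_value_le_gain_OPT[of "{n<..n + K}" "S K"] K\<epsilon>[OF less.prems]
          by (simp add: total_size_def total_value_def length_S S_small small_def subset_iff)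
        finally show False
          using gain_OPT_less[OF valid_S S_nonempty, of K] by linarith
      qed
    qed
  qed
  then show ?thesis
    using that \<epsilon>_pos small_\<epsilon> unfolding large_def by blast
qed

end

section \<open>Choice of \<open>c\<close> and the final contradiction\<close>

theorem theorem3:
  fixes \<alpha> :: real and A :: algorithm
  assumes "0 < \<alpha>" and "\<alpha> < 1 / 2"
    and "online_algorithm A"
  shows "competitive_ratio \<alpha> A \<ge>
    ereal (2 * (1 - \<alpha> + sqrt ((2 - 3 * \<alpha>) * \<alpha>)) / (1 - 2 * \<alpha>)\<^sup>2)"
proof (rule ccontr)
  define s where "s = sqrt ((2 - 3 * \<alpha>) * \<alpha>)"
  define q where "q = (1 - 2 * \<alpha>)\<^sup>2"
  have s: "0 < s" "s\<^sup>2 = (2 - 3 * \<alpha>) * \<alpha>"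
    using assms(1,2) by (auto simp: s_def)
  have q: "0 < q"
    using assms(2) by (simp add: q_def)
  assume "\<not> ?thesis"
  then have "competitive_ratio \<alpha> A < ereal (2 * (1 - \<alpha> + s) / q)"
    by (simp add: s_def q_def not_le)
  moreover have "ereal (2 * (1 - \<alpha>) / q) < ereal (2 * (1 - \<alpha> + s) / q)"
    using s q by (simp add: divide_strict_right_mono)
  \<comment> \<open>The minimum of the quadratic whose larger root is the claimed bound is at \<open>2 * (1 - \<alpha>) / q\<close>.\<close>
  ultimately have "max (competitive_ratio \<alpha> A) (ereal (2 * (1 - \<alpha>) / q))
      < ereal (2 * (1 - \<alpha> + s) / q)"
    by simp
  then obtain c where "max (competitive_ratio \<alpha> A) (ereal (2 * (1 - \<alpha>) / q)) < ereal c"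
    and "ereal c < ereal (2 * (1 - \<alpha> + s) / q)"
    using ereal_dense2 by blast
  then have CR: "competitive_ratio \<alpha> A < ereal c"
    and c_gt: "2 * (1 - \<alpha>) / q < c" and c_less: "c < 2 * (1 - \<alpha> + s) / q"
    by auto
  have "0 < 2 * (1 - \<alpha>) / q"
    using assms(2) q by simp
  then have c: "0 < c"
    using c_gt by linarith
  have disc: "(1 - 2 * \<alpha>)\<^sup>2 * c\<^sup>2 - 4 * (1 - \<alpha>) * c + 4 < 0"
  proof -
    \<comment> \<open>The quadratic times \<open>q\<close> is a square minus
      \<open>4 * s * s\<close>. Positivity of the base, from \<open>c_gt\<close>, permits squaring
      the upper bound.\<close>
    have "0 < q * c - 2 * (1 - \<alpha>)" "q * c - 2 * (1 - \<alpha>) < 2 * s"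
      using c_gt c_less q by (simp_all add: field_simps)
    then have "(q * c - 2 * (1 - \<alpha>))\<^sup>2 < (2 * s)\<^sup>2"
      by (intro power_strict_mono) auto
    moreover have "(2 * s)\<^sup>2 = 4 * (1 - \<alpha>)\<^sup>2 - 4 * q"
      by (simp add: power_mult_distrib s q_def) (simp add: power2_eq_square algebra_simps)
    ultimately have "q * (q * c\<^sup>2 - 4 * (1 - \<alpha>) * c + 4) < 0"
      by (simp add: power2_eq_square algebra_simps)
    then show ?thesis
      using q by (simp add: mult_less_0_iff q_def)
  qed
  interpret competitive_algorithm \<alpha> c A
  proof
    fix S assume S: "valid_sequence S" "S \<noteq> []"
    have "ratio \<alpha> A S \<le> competitive_ratio \<alpha> A"
      unfolding competitive_ratio_def using S by (intro SUP_upper) simp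
    then have "ratio \<alpha> A S < ereal c"
      using CR by simp
    \<comment> \<open>A finite bound excludes the infinite branch of \<open>ratio\<close>, because
      the optimum of a nonempty sequence is positive.\<close>
    then have "0 < gain \<alpha> A S \<and> gain_OPT S / gain \<alpha> A S < c"
      using gain_OPT_pos[OF S] by (auto simp: ratio_def split: if_splits)
    then show "gain_OPT S < c * gain \<alpha> A S"
      using pos_divide_less_eq by blast
  qed (use assms c in auto)
  obtain V :: "nat \<Rightarrow> real" and N :: nat
    where V_pos: "\<And>n. 0 < V n" and V_mono: "incseq V"
      and V_step: "\<And>n. c * ((1 - \<alpha>) * V n - \<alpha> * (\<Sum>i\<le>n. V i)) \<le> V n + V (Suc n)"
      and exhausted: "V N \<le> \<alpha> * (\<Sum>i\<le>N. V i)"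
    using offered_values[OF assms(1,2) c disc] by metis
  obtain \<epsilon> where \<epsilon>: "0 < \<epsilon>" "\<And>i. i \<le> N \<Longrightarrow> real i * \<epsilon> < 1 / 2"
    and reserves: "\<And>n. n \<le> N \<Longrightarrow>
      decide A (map (\<lambda>i. Item (1 - real i * \<epsilon>) (V i)) [0..<Suc n]) = Reserve"
    using reserves_all_large_items[OF V_pos V_mono V_step] by metis
  define S where "S = map (\<lambda>i. Item (1 - real i * \<epsilon>) (V i)) [0..<Suc N]"
  have S_nth: "S ! i = Item (1 - real i * \<epsilon>) (V i)" if "i \<le> N" for i
    using that by (simp add: S_def del: upt_Suc)
  have valid: "valid_sequence S"
    unfolding valid_sequence_def
  proof
    fix x assume "x \<in> set S"
    then have "x \<in> (\<lambda>i. Item (1 - real i * \<epsilon>) (V i)) ` {..N}"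
      by (simp add: S_def atLeast0LessThan lessThan_Suc_atMost del: upt_Suc)
    then obtain i where "i \<le> N" "x = Item (1 - real i * \<epsilon>) (V i)"
      by blast
    then show "valid_item x"
      using \<epsilon>(1) \<epsilon>(2)[of i] V_pos by (simp add: valid_item_def)
  qed
  have "decide A (take (Suc i) S) = Reserve" if "i \<le> N" for i
    using reserves[OF that] that by (simp add: S_def take_map take_upt del: upt_Suc)
  then have pos: "positions A Reserve S = {..N}"
    by (auto simp: positions_def S_def less_Suc_eq_le)
  \<comment> \<open>All items exceed size 1/2, so at most one is packed, worth at most
    \<open>V N\<close>; by \<open>exhausted\<close> the reservation costs consume that.\<close>
  have "gain \<alpha> A S \<le> V N - \<alpha> * total_value S (positions A Reserve S)"
  proof (rule gain_le_if_reserved_conflict[OF valid])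
    fix i j assume "i \<in> positions A Reserve S" "j \<in> positions A Reserve S"
    then show "1 < item_size (S ! i) + item_size (S ! j)"
      using \<epsilon>(2)[of i] \<epsilon>(2)[of j] by (simp add: pos S_nth)
  qed (use V_pos V_mono in \<open>auto simp: pos S_nth less_imp_le incseqD\<close>)
  also have "\<dots> \<le> 0"
    using exhausted by (simp add: pos total_value_def S_nth)
  finally show False
    using gain_pos[OF valid] by (simp add: S_def)
qed

end
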